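(* In the setting of the context with a finite state space $\mathcal I$ and $\nu$ the uniform distribution on $\mathcal I$, consider random incumbents $X_n\in\mathcal X$ and states $I_n\in\mathcal I$ generated in the order $X_0,I_0\to I_1\to X_1\to I_2\to X_2\to\cdots$ with natural filtration $\mathcal F_n=\sigma((I_m,X_m)_{m\le n})$, such that conditionally on $\mathcal F_n$, $I_{n+1}\sim P_{X_n}(I_n,\cdot)$. Fix $p>0$ and suppose $\|X_n-X_{n-1}\|\le c\,\alpha_n$ almost surely, where $\alpha_n\le C_\alpha n^{-p}$ for some $C_\alpha>0$. Let $I^\star(x):=\{i\in\mathcal I:Q(x,\xi^{(i)})=\max_{I\in\mathcal I}Q(x,\xi^{(I)})\}$ and $\widetilde\Delta_n:=\max_{I\in\mathcal I}Q(X_n,\xi^{(I)})-\max_{j\notin I^\star(X_n)}Q(X_n,\xi^{(j)})$ (maximum over an empty set is $-\infty$), and suppose there exists $\Delta_\star>4\varepsilon$ such that $\Delta_\star\le\widetilde\Delta_n$ for all integers $n\ge0$ (almost surely). Then, for all $n\ge2$, $$\mathbb P\big(I_n\notin I^\star(X_{n-1})\big)\le\bar\eta^{\,n-1}\,\mathbb P\big(I_1\notin I^\star(X_0)\big)+\frac{2c\bar\eta L_Q'}{\Delta_\star-4\varepsilon}\sum_{t=1}^{n-1}\bar\eta^{\,n-1-t}\alpha_t+\frac{1-\bar\eta^{\,n-1}}{1-\bar\eta}(|\mathcal I|-1)e^{-(\Delta_\star-2\varepsilon)/w}.$$ In addition, for all $n\ge n_0:=\max\Big\{2,\,1+\Big\lceil\big(\tfrac{2cC_\alpha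 L_Q'}{\Delta_\star-4\varepsilon}\big)^{1/p}\Big\rceil\Big\}$, $$\mathbb P\big(I_n\notin I^\star(X_{n-1})\big)\le\bar\eta^{\,n-n_0}+\frac{1-\bar\eta^{\,n-1}}{1-\bar\eta}(|\mathcal I|-1)e^{-(\Delta_\star-2\varepsilon)/w}.$$
   Context: $(\mathcal X,\|\cdot\|)$ is a set of decisions $\mathcal X\subseteq\mathbb R^{d_x}$ with a norm distance. $\mathcal I$ is a finite nonempty set indexing scenarios $\xi^{(i)}\in\Xi$ with $\max_{i\in\mathcal I}Q(x,\xi^{(i)})=\sup_{\xi\in\Xi}Q(x,\xi)$; $Q(x,\xi)\in\mathbb R$ is the optimal value of a recourse problem $\min_y\{b^\top y:Gy+Ex+U\xi-h\in\mathcal K\}$ ($\mathcal K$ a convex cone). For each $x$, $\widehat Q_x:\mathcal I\to\mathbb R$ is a score with $\max_i|Q(x,\xi^{(i)})-\widehat Q_x(i)|\le\varepsilon$ for all $x\in\mathcal X$, where $\varepsilon\ge0$. For $w>0$, $p_x^w(i)=\exp(\widehat Q_x(i)/w)/\sum_{j\in\mathcal I}\exp(\widehat Q_x(j)/w)$. For each $x$, $P_x$ is a Markov kernel on $\mathcal I$ with invariant distribution $p_x^w$. Total variation is $\|P-P'\|_{\mathrm{TV}}=\sup_B|P(B)-P'(B)|$. Assumptions: (Lipschitz score) $|\widehat Q_x(i)-\widehat Q_{x'}(i)|\le L_Q'\|x-x'\|$ for all $i\in\mathcal I$, $x,x'\in\mathcal X$; (Lipschitz kernel) there is $L_P$ with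 $\sup_{I\in\mathcal I}\|P_x(I,\cdot)-P_y(I,\cdot)\|_{\mathrm{TV}}\le L_P\|x-y\|$ for all $x,y\in\mathcal X$; (uniform mixing) $\sup_{I,J\in\mathcal I}\|P_x(I,\cdot)-P_x(J,\cdot)\|_{\mathrm{TV}}\le\bar\eta$ for all $x\in\mathcal X$, with $\bar\eta\in[0,1)$. Convention: $0^0=1$. *)

theory Defs
  imports "HOL-Analysis.Analysis" "HOL-Probability.Probability"
begin

definition is_norm :: "('a::real_vector \<Rightarrow> real) \<Rightarrow> bool" where
  "is_norm N \<longleftrightarrow>
     (\<forall>x. 0 \<le> N x) \<and> (\<forall>x. N x = 0 \<longleftrightarrow> x = 0) \<and>
     (\<forall>a x. N (a *\<^sub>R x) = \<bar>a\<bar> * N x) \<and> (\<forall>x y. N (x + y) \<le> N x + N y)"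

(* Extended-real valued: \<infinity> if infeasible, -\<infinity> if unbounded below.  The infimum is not
   required to be attained. *)
definition recourse_value ::
  "real^'dy \<Rightarrow> real^'dy^'m \<Rightarrow> real^'dx^'m \<Rightarrow> real^'ds^'m \<Rightarrow> real^'m \<Rightarrow> (real^'m) set
     \<Rightarrow> real^'dx \<Rightarrow> real^'ds \<Rightarrow> ereal" where
  "recourse_value b G E U h K x s =
     (INF y\<in>{y. G *v y + E *v x + U *v s - h \<in> K}. ereal (b \<bullet> y))"

definition gibbs_pmf :: "real \<Rightarrow> ('i::finite \<Rightarrow> real) \<Rightarrow> 'i pmf" where
  "gibbs_pmf w q = embed_pmf (\<lambda>i. exp (q i / w) / (\<Sum>j\<in>UNIV. exp (q j / w)))"

lemma pmf_gibbs_pmf: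
  "pmf (gibbs_pmf w q) i = exp (q i / w) / (\<Sum>j\<in>UNIV. exp (q j / w))"
proof -
  let ?Z = "\<Sum>j\<in>UNIV. exp (q j / w)"
  have Z: "?Z > 0" by (intro sum_pos) auto
  have "(\<integral>\<^sup>+ i. ennreal (exp (q i / w) / ?Z) \<partial>count_space UNIV)
          = (\<Sum>i\<in>UNIV. ennreal (exp (q i / w) / ?Z))"
    by (simp add: nn_integral_count_space_finite)
  also have "\<dots> = ennreal (\<Sum>i\<in>UNIV. exp (q i / w) / ?Z)"
    using Z by (intro sum_ennreal) auto
  also have "(\<Sum>i\<in>UNIV. exp (q i / w) / ?Z) = 1"
    using Z by (simp add: sum_divide_distrib[symmetric])
  finally show ?thesis
    unfolding gibbs_pmf_def using Z by (intro pmf_embed_pmf) auto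
qed

(* All subsets are events, as is appropriate for discrete distributions. *)
definition tv_dist :: "'i pmf \<Rightarrow> 'i pmf \<Rightarrow> real" where
  "tv_dist p q = (SUP B. \<bar>measure (measure_pmf p) B - measure (measure_pmf q) B\<bar>)"

definition invariant_pmf :: "'i pmf \<Rightarrow> ('i \<Rightarrow> 'i pmf) \<Rightarrow> bool" where
  "invariant_pmf p k \<longleftrightarrow> bind_pmf p k = p"

definition natural_filtration ::
  "'w measure \<Rightarrow> 'b measure \<Rightarrow> (nat \<Rightarrow> 'w \<Rightarrow> 'b) \<Rightarrow> nat \<Rightarrow> 'w measure" where
  "natural_filtration M S Z n =
     sigma (space M) (\<Union>m\<in>{..n}. {Z m -` A \<inter> space M | A. A \<in> sets S})"

definition max_value :: "('x \<Rightarrow> 's \<Rightarrow> real) \<Rightarrow> ('i::finite \<Rightarrow> 's) \<Rightarrow> 'x \<Rightarrow> real" where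
  "max_value Q \<xi> x = Max (range (\<lambda>i. Q x (\<xi> i)))"

definition opt_scenarios :: "('x \<Rightarrow> 's \<Rightarrow> real) \<Rightarrow> ('i::finite \<Rightarrow> 's) \<Rightarrow> 'x \<Rightarrow> 'i set" where
  "opt_scenarios Q \<xi> x = {i. Q x (\<xi> i) = max_value Q \<xi> x}"

(* The supremum in ereal of the empty set is -\<infinity>, so the gap is \<infinity> when every scenario is
   optimal; otherwise the supremum is the maximum of a finite set. *)
definition gap :: "('x \<Rightarrow> 's \<Rightarrow> real) \<Rightarrow> ('i::finite \<Rightarrow> 's) \<Rightarrow> 'x \<Rightarrow> ereal" where
  "gap Q \<xi> x = ereal (max_value Q \<xi> x) - (SUP j\<in>- opt_scenarios Q \<xi> x. ereal (Q x (\<xi> j)))"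

end

(* Invariance gives p(i) P(i,j) <= p(j), so from an optimal scenario the kernel reaches any given
   non-optimal one with probability at most p(j) / p(i) <= exp (- (Delta - 2 eps) / w); by mixing,
   from a non-optimal scenario the probability of landing on a non-optimal one is larger by at most
   eta.  When the incumbent moves, an optimal scenario can become non-optimal only if the score
   differences change by at least Delta - 4 eps, which forces 2 LQ c alpha_n >= Delta - 4 eps.
   Hence the error probabilities satisfy
   a(n+1) <= eta (a(n) + 2 c LQ alpha_n / (Delta - 4 eps)) + (card I - 1) exp (- (Delta - 2 eps) / w),
   where the alpha_n term disappears for n >= n0. *)
theory Submission
  imports Defs
begin

text \<open>Boundedness is what makes the real-valued \<open>SUP\<close> in \<open>tv_dist\<close>
  an upper bound for each of its members.\<close>

lemma tv_dist_bdd_above: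
  "bdd_above (range (\<lambda>B. \<bar>measure (measure_pmf p) B - measure (measure_pmf q) B\<bar>))"
proof (rule bdd_aboveI)
  fix y assume "y \<in> range (\<lambda>B. \<bar>measure (measure_pmf p) B - measure (measure_pmf q) B\<bar>)"
  then obtain B where "y = \<bar>measure (measure_pmf p) B - measure (measure_pmf q) B\<bar>" by blast
  then show "y \<le> 1"
    using measure_pmf.prob_le_1[of p B] measure_pmf.prob_le_1[of q B]
      measure_nonneg[of "measure_pmf p" B] measure_nonneg[of "measure_pmf q" B]
    by linarith
qed

lemma measure_le_tv_dist:
  "measure (measure_pmf p) B \<le> measure (measure_pmf q) B + tv_dist p q"
proof -
  have "\<bar>measure (measure_pmf p) B - measure (measure_pmf q) B\<bar> \<le> tv_dist p q"
    unfolding tv_dist_def by (rule cSUP_upper[OF _ tv_dist_bdd_above]) simp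
  then show ?thesis by linarith
qed

text \<open>Finitely many pairs give a bounded family, so its real supremum dominates each member.
  This turns uniform mixing into a bound for two given rows of the kernel.\<close>

lemma tv_dist_le_SUP:
  fixes k :: "'i::finite \<Rightarrow> 'i pmf"
  shows "tv_dist (k i) (k j) \<le> (SUP (i, j). tv_dist (k i) (k j))"
  by (rule cSUP_upper2[where x = "(i, j)"]) auto

text \<open>Keeping only the summand a = i of the invariance equation leaves p(i) P(i,j) <= p(j),
  and the normalising constant \<open>?Z\<close> cancels in p(j) / p(i).\<close>

lemma pmf_gibbs_invariant_le:
  fixes k :: "'i::finite \<Rightarrow> 'i pmf"
  assumes "invariant_pmf (gibbs_pmf w q) k"
  shows "pmf (k i) j \<le> exp ((q j - q i) / w)"
proof -
  let ?p = "gibbs_pmf w q" and ?Z = "\<Sum>j\<in>UNIV. exp (q j / w)"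
  have Z: "?Z > 0" by (intro sum_pos) auto
  have "pmf ?p j = pmf (bind_pmf ?p k) j"
    using assms by (simp add: invariant_pmf_def)
  also have "\<dots> = (\<Sum>a\<in>UNIV. pmf (k a) j * pmf ?p a)"
    by (subst pmf_bind, subst integral_measure_pmf_real[where A = UNIV]) auto
  finally have "pmf (k i) j * pmf ?p i \<le> pmf ?p j"
    by (metis (no_types, lifting) UNIV_I finite_code member_le_sum mult_nonneg_nonneg pmf_nonneg)
  then have "pmf (k i) j * exp (q i / w) \<le> exp (q j / w)"
    using Z by (simp add: pmf_gibbs_pmf field_simps)
  then show ?thesis
    by (simp add: diff_divide_distrib exp_diff field_simps)
qed

text \<open>Sum the previous pointwise bound over the states outside \<open>A\<close>. As
  \<open>i\<close> lies in \<open>A\<close>, there are at most \<open>CARD('i) - 1\<close> of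
  them.\<close>

lemma measure_leave_le:
  fixes k :: "'i::finite \<Rightarrow> 'i pmf"
  assumes "invariant_pmf (gibbs_pmf w q) k" and "0 < w" and "i \<in> A"
    and "\<And>j. j \<notin> A \<Longrightarrow> q j + g \<le> q i"
  shows "measure (measure_pmf (k i)) (- A) \<le> (real CARD('i) - 1) * exp (- g / w)"
proof -
  have "measure (measure_pmf (k i)) (- A) = (\<Sum>j\<in>- A. pmf (k i) j)"
    by (simp add: measure_measure_pmf_finite)
  also have "\<dots> \<le> (\<Sum>j\<in>- A. exp (- g / w))"
  proof (rule sum_mono)
    fix j assume "j \<in> - A"
    then have "(q j - q i) / w \<le> - g / w"
      using assms(2) assms(4)[of j] by (intro divide_right_mono) auto
    then show "pmf (k i) j \<le> exp (- g / w)"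
      using pmf_gibbs_invariant_le[OF assms(1), of i j] by (meson exp_le_cancel_iff order_trans)
  qed
  also have "\<dots> = real (card (- A)) * exp (- g / w)" by simp
  also have "\<dots> \<le> (real CARD('i) - 1) * exp (- g / w)"
  proof (rule mult_right_mono)
    have "card (- A) \<le> card (UNIV - {i})" using assms(3) by (intro card_mono) auto
    also have "\<dots> = CARD('i) - 1" by (simp add: card_Diff_singleton)
    finally show "real (card (- A)) \<le> real CARD('i) - 1"
      using zero_less_card_finite[where 'a = 'i] by linarith
  qed simp
  finally show ?thesis .
qed

text \<open>Replacing \<open>Max\<close> by finitely many comparisons serves both the measurability
  of non-optimality and the comparison of scores after a move.\<close>

lemma opt_scenarios_iff:
  "i \<in> opt_scenarios Q \<xi> x \<longleftrightarrow> (\<forall>j. Q x (\<xi> j) \<le> Q x (\<xi> i))"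
proof -
  have "Max (range (\<lambda>i. Q x (\<xi> i))) \<in> range (\<lambda>i. Q x (\<xi> i))" by (rule Max_in) auto
  then show ?thesis
    unfolding opt_scenarios_def max_value_def mem_Collect_eq
    by (smt (verit) Max_ge finite finite_imageI imageE rangeI)
qed

lemma opt_scenarios_nonempty: "\<exists>i. i \<in> opt_scenarios Q \<xi> x"
proof -
  have "Max (range (\<lambda>i. Q x (\<xi> i))) \<in> range (\<lambda>i. Q x (\<xi> i))" by (rule Max_in) auto
  then obtain i where "Q x (\<xi> i) = max_value Q \<xi> x" unfolding max_value_def by (metis imageE)
  then show ?thesis unfolding opt_scenarios_def by blast
qed

text \<open>The supremum in \<open>gap\<close> is at least its member at \<open>j\<close>. The given
  \<open>j\<close> also excludes the infinite gap, so the bound becomes one between reals.\<close>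

lemma gap_le_diff:
  assumes "ereal d \<le> gap Q \<xi> x" and "i \<in> opt_scenarios Q \<xi> x" and "j \<notin> opt_scenarios Q \<xi> x"
  shows "Q x (\<xi> j) + d \<le> Q x (\<xi> i)"
proof -
  have "ereal (Q x (\<xi> j)) \<le> (SUP j\<in>- opt_scenarios Q \<xi> x. ereal (Q x (\<xi> j)))"
    using assms(3) by (intro SUP_upper) auto
  then have "gap Q \<xi> x \<le> ereal (max_value Q \<xi> x) - ereal (Q x (\<xi> j))"
    unfolding gap_def by (intro ereal_minus_mono) auto
  with assms(1) have "ereal d \<le> ereal (max_value Q \<xi> x) - ereal (Q x (\<xi> j))"
    by (rule order_trans)
  then show ?thesis using assms(2) by (simp add: opt_scenarios_def)
qed

text \<open>Discrete variation of constants. The starting index \<open>m\<close> is free because the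
  recursion is later unrolled from 1 and from \<open>n\<^sub>0\<close>.\<close>

lemma affine_recursion_le:
  fixes u v :: "nat \<Rightarrow> real"
  assumes "0 \<le> r" and "\<And>n. m \<le> n \<Longrightarrow> u (Suc n) \<le> r * u n + v n" and "m \<le> n"
  shows "u n \<le> r ^ (n - m) * u m + (\<Sum>t=m..<n. r ^ (n - 1 - t) * v t)"
  using assms(3)
proof (induction n rule: dec_induct)
  case base
  show ?case by simp
next
  case (step n)
  have "u (Suc n) \<le> r * u n + v n" using assms(2) step(1) by simp
  also have "\<dots> \<le> r * (r ^ (n - m) * u m + (\<Sum>t=m..<n. r ^ (n - 1 - t) * v t)) + v n"
    using step.IH assms(1) by (simp add: mult_left_mono)
  also have "\<dots> = r ^ (Suc n - m) * u m + ((\<Sum>t=m..<n. r * (r ^ (n - 1 - t) * v t)) + v n)"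
    using step(1) by (simp add: Suc_diff_le distrib_left sum_distrib_left)
  also have "(\<Sum>t=m..<n. r * (r ^ (n - 1 - t) * v t)) = (\<Sum>t=m..<n. r ^ (Suc n - 1 - t) * v t)"
  proof (rule sum.cong)
    fix t assume "t \<in> {m..<n}"
    \<comment> \<open>Truncated subtraction is exact here because t < n.\<close>
    then have "Suc n - 1 - t = Suc (n - 1 - t)" by auto
    then show "r * (r ^ (n - 1 - t) * v t) = r ^ (Suc n - 1 - t) * v t" by simp
  qed simp
  finally show ?case using step(1) by simp
qed

lemma sum_power_rev:
  fixes r :: real
  assumes "r \<noteq> 1"
  shows "(\<Sum>t=m..<n. r ^ (n - 1 - t)) = (1 - r ^ (n - m)) / (1 - r)"
proof -
  have "(\<Sum>t=m..<n. r ^ (n - 1 - t)) = (\<Sum>i<n - m. r ^ i)"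
    by (rule sum.reindex_bij_witness[where i = "\<lambda>i. n - 1 - i" and j = "\<lambda>t. n - 1 - t"]) auto
  also have "\<dots> = (1 - r ^ (n - m)) / (1 - r)"
    using assms by (simp add: sum_gp_strict)
  finally show ?thesis .
qed

text \<open>The set \<open>S\<close> is random, but each event that it contains \<open>j\<close>
  lies in \<open>F\<close>. Splitting by the value \<open>j\<close> of \<open>J\<close> gives
  disjoint pieces, on each of which the indicator of J = j may be replaced by its conditional
  expectation \<open>r j\<close>. This allows the next state to be tested against a set that depends
  on the current incumbent.\<close>

lemma (in prob_space) prob_le_of_cond_exp:
  fixes J :: "'a \<Rightarrow> 'i::finite"
  assumes sub: "subalgebra M F"
    and J: "J \<in> measurable M (count_space UNIV)"
    and S: "\<And>j. {\<omega> \<in> space M. j \<in> S \<omega>} \<in> sets F"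
    and r: "\<And>j. AE \<omega> in M. real_cond_exp M F (indicator {\<omega> \<in> space M. J \<omega> = j}) \<omega> = r j \<omega>"
    and g: "integrable M g" and le: "AE \<omega> in M. (\<Sum>j\<in>S \<omega>. r j \<omega>) \<le> g \<omega>"
  shows "prob {\<omega> \<in> space M. J \<omega> \<in> S \<omega>} \<le> (\<integral>\<omega>. g \<omega> \<partial>M)"
proof -
  interpret finite_measure_subalgebra M F
    by unfold_locales (rule sub)
  define A where "A j = {\<omega> \<in> space M. j \<in> S \<omega>}" for j
  define D where "D j = {\<omega> \<in> space M. J \<omega> = j}" for j
  have A: "A j \<in> sets F" "A j \<in> sets M" for j
    using S sub unfolding A_def subalgebra_def by auto
  have D: "D j \<in> sets M" for j
    using measurable_sets[OF J, of "{j}"] by (auto simp: D_def vimage_def Int_def conj_commute)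
  have iD: "integrable M (indicator (D j) :: 'a \<Rightarrow> real)" for j
    using D by (intro integrable_real_indicator) (auto simp: emeasure_eq_measure)
  have icD: "integrable M (\<lambda>\<omega>. indicator (A j) \<omega> * real_cond_exp M F (indicator (D j)) \<omega>)" for j
    using integrable_mult_indicator[OF A(2) real_cond_exp_int(1)[OF iD]] by simp
  have "prob {\<omega> \<in> space M. J \<omega> \<in> S \<omega>} = prob (\<Union>j\<in>UNIV. A j \<inter> D j)"
    by (rule arg_cong[where f = prob]) (auto simp: A_def D_def)
  also have "\<dots> = (\<Sum>j\<in>UNIV. prob (A j \<inter> D j))"
    using A D by (intro finite_measure_finite_Union) (auto simp: disjoint_family_on_def D_def)
  also have "\<dots> = (\<Sum>j\<in>UNIV. \<integral>\<omega>. indicator (A j) \<omega> * real_cond_exp M F (indicator (D j)) \<omega> \<partial>M)"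
  proof (rule sum.cong)
    fix j
    have "prob (A j \<inter> D j) = (\<integral>\<omega>\<in>A j. indicator (D j) \<omega> \<partial>M)"
      using A D by (simp add: set_lebesgue_integral_def indicator_inter_arith[symmetric])
    also have "\<dots> = (\<integral>\<omega>\<in>A j. real_cond_exp M F (indicator (D j)) \<omega> \<partial>M)"
      by (rule real_cond_exp_intA[OF iD A(1)])
    finally show "prob (A j \<inter> D j)
        = (\<integral>\<omega>. indicator (A j) \<omega> * real_cond_exp M F (indicator (D j)) \<omega> \<partial>M)"
      by (simp add: set_lebesgue_integral_def)
  qed simp
  also have "\<dots> = (\<integral>\<omega>. (\<Sum>j\<in>UNIV. indicator (A j) \<omega> * real_cond_exp M F (indicator (D j)) \<omega>) \<partial>M)"
    using icD by (intro Bochner_Integration.integral_sum[symmetric])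
  also have "\<dots> \<le> (\<integral>\<omega>. g \<omega> \<partial>M)"
  proof (rule integral_mono_AE)
    \<comment> \<open>There are finitely many \<open>j\<close>, so one null set covers all
      exceptions.\<close>
    have "AE \<omega> in M. \<forall>j\<in>UNIV. real_cond_exp M F (indicator (D j)) \<omega> = r j \<omega>"
      using r by (intro AE_finite_allI) (auto simp: D_def)
    with le AE_space show "AE \<omega> in M.
        (\<Sum>j\<in>UNIV. indicator (A j) \<omega> * real_cond_exp M F (indicator (D j)) \<omega>) \<le> g \<omega>"
    proof eventually_elim
      case (elim \<omega>)
      have "(\<Sum>j\<in>UNIV. indicator (A j) \<omega> * real_cond_exp M F (indicator (D j)) \<omega>)
          = (\<Sum>j\<in>UNIV. if j \<in> S \<omega> then r j \<omega> else 0)"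
        using elim by (intro sum.cong) (auto simp: A_def)
      also have "\<dots> = (\<Sum>j\<in>S \<omega>. r j \<omega>)" by (simp add: sum.If_cases)
      finally show ?case using elim by simp
    qed
  qed (intro Bochner_Integration.integrable_sum icD, rule g)
  finally show ?thesis .
qed

lemma subalgebra_natural_filtration:
  assumes "\<And>n. Z n \<in> measurable M S"
  shows "subalgebra M (natural_filtration M S Z n)"
  unfolding subalgebra_def natural_filtration_def
  using measurable_sets[OF assms]
  by (auto simp: space_measure_of_conv sets_measure_of_conv intro!: sets.sigma_sets_subset)

lemma vimage_in_natural_filtration:
  assumes "A \<in> sets S"
  shows "Z n -` A \<inter> space M \<in> sets (natural_filtration M S Z n)"
  unfolding natural_filtration_def
  by (subst sets_measure_of) (use assms in \<open>auto intro!: sigma_sets.Basic\<close>)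

theorem theorem3:
  fixes N :: "real^'dx \<Rightarrow> real" and \<X> :: "(real^'dx) set"
    and b :: "real^'dy" and G :: "real^'dy^'m" and E :: "real^'dx^'m"
    and U :: "real^'ds^'m" and h :: "real^'m" and K :: "(real^'m) set"
    and \<Xi> :: "(real^'ds) set" and \<xi> :: "'i::finite \<Rightarrow> real^'ds"
    and Q :: "real^'dx \<Rightarrow> real^'ds \<Rightarrow> real" and Qhat :: "real^'dx \<Rightarrow> 'i \<Rightarrow> real"
    and P :: "real^'dx \<Rightarrow> 'i \<Rightarrow> 'i pmf"
    and M :: "'w measure" and X :: "nat \<Rightarrow> 'w \<Rightarrow> real^'dx" and I :: "nat \<Rightarrow> 'w \<Rightarrow> 'i"
    and F :: "nat \<Rightarrow> 'w measure" and \<alpha> :: "nat \<Rightarrow> real"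
    and \<epsilon> w LQ LP \<eta> p c C\<alpha> \<Delta> :: real
  assumes norm: "is_norm N"
    and cone: "convex_cone K"
    and Q_value: "\<And>x s. x \<in> \<X> \<Longrightarrow> s \<in> \<Xi> \<Longrightarrow> recourse_value b G E U h K x s = ereal (Q x s)"
    and Q_borel: "\<And>i. (\<lambda>x. Q x (\<xi> i)) \<in> borel_measurable (restrict_space borel \<X>)"
    and scenarios: "\<And>i. \<xi> i \<in> \<Xi>"
    and scenarios_max:
      "\<And>x. x \<in> \<X> \<Longrightarrow> ereal (Max (range (\<lambda>i. Q x (\<xi> i)))) = (SUP s\<in>\<Xi>. ereal (Q x s))"
    and eps: "0 \<le> \<epsilon>"
    and score_error: "\<And>x. x \<in> \<X> \<Longrightarrow> Max (range (\<lambda>i. \<bar>Q x (\<xi> i) - Qhat x i\<bar>)) \<le> \<epsilon>"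
    and w: "0 < w"
    and invariant: "\<And>x. x \<in> \<X> \<Longrightarrow> invariant_pmf (gibbs_pmf w (Qhat x)) (P x)"
    and LQ: "0 \<le> LQ"
    and score_lipschitz:
      "\<And>i x x'. x \<in> \<X> \<Longrightarrow> x' \<in> \<X> \<Longrightarrow> \<bar>Qhat x i - Qhat x' i\<bar> \<le> LQ * N (x - x')"
    and kernel_lipschitz:
      "\<And>x y. x \<in> \<X> \<Longrightarrow> y \<in> \<X> \<Longrightarrow> (SUP i. tv_dist (P x i) (P y i)) \<le> LP * N (x - y)"
    and eta: "0 \<le> \<eta>" "\<eta> < 1"
    and mixing: "\<And>x. x \<in> \<X> \<Longrightarrow> (SUP (i, j). tv_dist (P x i) (P x j)) \<le> \<eta>"
    and prob: "prob_space M"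
    and X_rv: "\<And>n. X n \<in> measurable M (restrict_space borel \<X>)"
    and I_rv: "\<And>n. I n \<in> measurable M (count_space UNIV)"
    and F_def: "F = natural_filtration M (count_space UNIV \<Otimes>\<^sub>M restrict_space borel \<X>)
                      (\<lambda>m \<omega>. (I m \<omega>, X m \<omega>))"
    and transition: "\<And>n j. AE \<omega> in M.
      real_cond_exp M (F n) (indicator {\<omega> \<in> space M. I (Suc n) \<omega> = j}) \<omega>
        = pmf (P (X n \<omega>) (I n \<omega>)) j"
    and p: "0 < p" and c: "0 \<le> c" and C\<alpha>: "0 < C\<alpha>"
    and steps: "\<And>n. 1 \<le> n \<Longrightarrow> AE \<omega> in M. N (X n \<omega> - X (n - 1) \<omega>) \<le> c * \<alpha> n"
    and \<alpha>_bound: "\<And>n. 1 \<le> n \<Longrightarrow> \<alpha> n \<le> C\<alpha> * real n powr (- p)"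
    and \<Delta>: "4 * \<epsilon> < \<Delta>"
    and \<Delta>_gap: "\<And>n. AE \<omega> in M. ereal \<Delta> \<le> gap Q \<xi> (X n \<omega>)"
  shows "(\<forall>n\<ge>2.
      measure M {\<omega> \<in> space M. I n \<omega> \<notin> opt_scenarios Q \<xi> (X (n - 1) \<omega>)}
        \<le> \<eta> ^ (n - 1) * measure M {\<omega> \<in> space M. I 1 \<omega> \<notin> opt_scenarios Q \<xi> (X 0 \<omega>)}
          + 2 * c * \<eta> * LQ / (\<Delta> - 4 * \<epsilon>) * (\<Sum>t=1..n - 1. \<eta> ^ (n - 1 - t) * \<alpha> t)
          + (1 - \<eta> ^ (n - 1)) / (1 - \<eta>) * (real CARD('i) - 1) * exp (- (\<Delta> - 2 * \<epsilon>) / w)) \<and>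
    (let n\<^sub>0 = max 2 (1 + nat \<lceil>(2 * c * C\<alpha> * LQ / (\<Delta> - 4 * \<epsilon>)) powr (1 / p)\<rceil>) in
      \<forall>n\<ge>n\<^sub>0.
      measure M {\<omega> \<in> space M. I n \<omega> \<notin> opt_scenarios Q \<xi> (X (n - 1) \<omega>)}
        \<le> \<eta> ^ (n - n\<^sub>0)
          + (1 - \<eta> ^ (n - 1)) / (1 - \<eta>) * (real CARD('i) - 1) * exp (- (\<Delta> - 2 * \<epsilon>) / w))"
proof -
  interpret prob_space M by (rule prob)
  \<comment> \<open>\<open>\<delta>\<close> will bound the chance that one kernel step leaves the
    optimal set. \<open>\<kappa>\<close> is scaled so that a scenario can lose optimality at step n
    only if \<open>\<kappa> * \<alpha> n\<close> is at least 1.\<close>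
  define \<delta> where "\<delta> = (real CARD('i) - 1) * exp (- (\<Delta> - 2 * \<epsilon>) / w)"
  define \<kappa> where "\<kappa> = 2 * c * LQ / (\<Delta> - 4 * \<epsilon>)"
  define opt where "opt x = opt_scenarios Q \<xi> x" for x
  \<comment> \<open>\<open>a n\<close> judges \<open>I n\<close> against the incumbent that
    generated it, \<open>b' n\<close> against the updated one. At n = 0 truncation makes them equal,
    but the recursions start at 1 or later.\<close>
  define a where "a n = prob {\<omega> \<in> space M. I n \<omega> \<notin> opt (X (n - 1) \<omega>)}" for n
  define b' where "b' n = prob {\<omega> \<in> space M. I n \<omega> \<notin> opt (X n \<omega>)}" for n
  have \<delta>: "0 \<le> \<delta>"
    using zero_less_card_finite[where 'a = 'i] unfolding \<delta>_def
    by (intro mult_nonneg_nonneg) (linarith, simp)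
  have \<kappa>: "0 \<le> \<kappa>" using c LQ \<Delta> by (simp add: \<kappa>_def)

  \<comment> \<open>One kernel step at a fixed incumbent\<close>
  have X_in: "X n \<omega> \<in> \<X>" if "\<omega> \<in> space M" for n \<omega>
    using measurable_space[OF X_rv that] by (simp add: space_restrict_space)
  have err: "\<bar>Q x (\<xi> i) - Qhat x i\<bar> \<le> \<epsilon>" if "x \<in> \<X>" for x i
    by (rule order_trans[OF Max_ge score_error[OF that]]) auto
  \<comment> \<open>Passing from \<open>Q\<close> to \<open>Qhat\<close> costs
    \<open>\<epsilon>\<close> at each of the two scenarios.\<close>
  have score_gap: "Qhat x j + (\<Delta> - 2 * \<epsilon>) \<le> Qhat x i"
    if "x \<in> \<X>" "ereal \<Delta> \<le> gap Q \<xi> x" "i \<in> opt x" "j \<notin> opt x" for x i j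
    using gap_le_diff[of \<Delta> Q \<xi> x i j] that err[of x i] err[of x j]
    by (auto simp: opt_def)
  have leave: "(\<Sum>j\<in>- opt x. pmf (P x i) j) \<le> \<eta> * indicator (- opt x) i + \<delta>"
    if x: "x \<in> \<X>" "ereal \<Delta> \<le> gap Q \<xi> x" for x i
  proof -
    have stay: "measure (measure_pmf (P x l)) (- opt x) \<le> \<delta>" if "l \<in> opt x" for l
      unfolding \<delta>_def
      by (rule measure_leave_le[OF invariant[OF x(1)] w that score_gap[OF x that]])
    have "measure (measure_pmf (P x i)) (- opt x) \<le> \<eta> * indicator (- opt x) i + \<delta>"
    proof (cases "i \<in> opt x")
      case True
      then show ?thesis using stay by simp
    next
      case False
      \<comment> \<open>Row \<open>i\<close> is compared with the row of an optimal
        \<open>l\<close>, which satisfies \<open>stay\<close>; mixing adds at most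
        \<open>\<eta>\<close>.\<close>
      obtain l where l: "l \<in> opt x" using opt_scenarios_nonempty[of Q \<xi> x] unfolding opt_def by blast
      have "tv_dist (P x i) (P x l) \<le> \<eta>"
        using tv_dist_le_SUP mixing[OF x(1)] by (rule order_trans)
      then show ?thesis
        using False stay[OF l] measure_le_tv_dist[of "P x i" "- opt x" "P x l"] by simp
    qed
    then show ?thesis by (simp add: measure_measure_pmf_finite)
  qed

  \<comment> \<open>Measurability of the error events\<close>
  have Z_rv: "(\<lambda>\<omega>. (I n \<omega>, X n \<omega>)) \<in> M \<rightarrow>\<^sub>M count_space UNIV \<Otimes>\<^sub>M restrict_space borel \<X>" for n
    using I_rv X_rv by (rule measurable_Pair)
  have sub: "subalgebra M (F n)" for n
    unfolding F_def using Z_rv by (rule subalgebra_natural_filtration)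
  have nonopt_F: "{\<omega> \<in> space M. j \<in> - opt (X n \<omega>)} \<in> sets (F n)" for n j
  proof -
    note Q_borel[measurable]
    have "{x \<in> space (restrict_space borel \<X>). \<not> (\<forall>i. Q x (\<xi> i) \<le> Q x (\<xi> j))}
        \<in> sets (restrict_space borel \<X>)"
      by measurable
    then have "UNIV \<times> {x \<in> \<X>. j \<notin> opt x} \<in> sets (count_space UNIV \<Otimes>\<^sub>M restrict_space borel \<X>)"
      by (intro pair_measureI) (auto simp: opt_def opt_scenarios_iff space_restrict_space)
    from vimage_in_natural_filtration[OF this]
    have "(\<lambda>\<omega>. (I n \<omega>, X n \<omega>)) -` (UNIV \<times> {x \<in> \<X>. j \<notin> opt x}) \<inter> space M \<in> sets (F n)"
      unfolding F_def by this
    also have "(\<lambda>\<omega>. (I n \<omega>, X n \<omega>)) -` (UNIV \<times> {x \<in> \<X>. j \<notin> opt x}) \<inter> space M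
        = {\<omega> \<in> space M. j \<in> - opt (X n \<omega>)}"
      using X_in by auto
    finally show ?thesis .
  qed
  have ev: "{\<omega> \<in> space M. I n \<omega> \<notin> opt (X m \<omega>)} \<in> events" for n m
  proof -
    have "{\<omega> \<in> space M. I n \<omega> \<notin> opt (X m \<omega>)}
        = (\<Union>j. (I n -` {j} \<inter> space M) \<inter> {\<omega> \<in> space M. j \<in> - opt (X m \<omega>)})"
      by auto
    also have "\<dots> \<in> events"
    proof (rule sets.finite_UN[OF _ sets.Int])
      show "I n -` {j} \<inter> space M \<in> events" for j
        using I_rv by (rule measurable_sets) simp
      show "{\<omega> \<in> space M. j \<in> - opt (X m \<omega>)} \<in> events" for j
        using nonopt_F[of j m] sub[of m] unfolding subalgebra_def by blast
    qed simp
    finally show ?thesis .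
  qed
  \<comment> \<open>The incumbent \<open>X n\<close> is known at time n, so \<open>leave\<close> can
    be integrated conditionally on \<open>F n\<close>.\<close>
  have a_Suc: "a (Suc n) \<le> \<eta> * b' n + \<delta>" for n
  proof -
    let ?A = "{\<omega> \<in> space M. I n \<omega> \<notin> opt (X n \<omega>)}"
    have int: "integrable M (indicat_real ?A)"
      using ev by (intro integrable_real_indicator) (auto simp: emeasure_eq_measure)
    have "prob {\<omega> \<in> space M. I (Suc n) \<omega> \<in> - opt (X n \<omega>)}
        \<le> (\<integral>\<omega>. \<eta> * indicator ?A \<omega> + \<delta> \<partial>M)"
    proof (rule prob_le_of_cond_exp[OF sub I_rv nonopt_F transition])
      show "integrable M (\<lambda>\<omega>. \<eta> * indicator ?A \<omega> + \<delta>)" using int by simp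
      show "AE \<omega> in M. (\<Sum>j\<in>- opt (X n \<omega>). pmf (P (X n \<omega>) (I n \<omega>)) j) \<le> \<eta> * indicator ?A \<omega> + \<delta>"
        using \<Delta>_gap[of n] AE_space
      proof eventually_elim
        case (elim \<omega>)
        then show ?case
          using leave[OF X_in[OF elim(2)] elim(1), of "I n \<omega>"] by (auto simp: indicator_def)
      qed
    qed
    also have "\<dots> = \<eta> * b' n + \<delta>"
      using int ev by (simp add: b'_def prob_space)
    finally show ?thesis by (simp add: a_def)
  qed

  \<comment> \<open>Effect of moving the incumbent\<close>
  have \<kappa>\<alpha>: "0 \<le> \<kappa> * \<alpha> n" if "1 \<le> n" for n
  proof -
    have "AE \<omega> in M. 0 \<le> c * \<alpha> n"
      using steps[OF that]
    proof eventually_elim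
      case (elim \<omega>)
      then show ?case using norm unfolding is_norm_def by (meson order_trans)
    qed
    \<comment> \<open>A deterministic statement that holds almost surely in a probability space is
      true.\<close>
    then have "0 \<le> c * \<alpha> n" by simp
    then have "0 \<le> (c * \<alpha> n) * (2 * LQ / (\<Delta> - 4 * \<epsilon>))" 
      using LQ \<Delta> by (intro mult_nonneg_nonneg[of "c * \<alpha> n"]) auto
    then show ?thesis by (simp add: \<kappa>_def mult_ac)
  qed
  \<comment> \<open>Here \<open>x\<close> is the new and \<open>y\<close> the old incumbent. At
    \<open>x\<close> the score of \<open>i\<close> trails that of an optimal \<open>l\<close> by at
    least \<open>\<Delta> - 2 * \<epsilon>\<close>; at \<open>y\<close> it trails by at most
    \<open>2 * \<epsilon>\<close>. The difference must be covered by two Lipschitz bounds, one for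
    each scenario.\<close>
  have switch: "1 \<le> \<kappa> * \<alpha> n"
    if x: "x \<in> \<X>" "ereal \<Delta> \<le> gap Q \<xi> x" and y: "y \<in> \<X>" "N (x - y) \<le> c * \<alpha> n"
      and i: "i \<in> opt y" "i \<notin> opt x" for x y i n
  proof -
    obtain l where l: "l \<in> opt x" using opt_scenarios_nonempty[of Q \<xi> x] unfolding opt_def by blast
    have "Qhat x i + (\<Delta> - 2 * \<epsilon>) \<le> Qhat x l" by (rule score_gap[OF x l i(2)])
    moreover have "Qhat y l \<le> Qhat y i + 2 * \<epsilon>"
      using i(1) err[OF y(1), of i] err[OF y(1), of l]
      by (simp add: opt_def opt_scenarios_iff) (smt (verit))
    ultimately have "\<Delta> - 4 * \<epsilon> \<le> 2 * (LQ * N (x - y))"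
      using score_lipschitz[OF x(1) y(1), of i] score_lipschitz[OF x(1) y(1), of l] by linarith
    also have "\<dots> \<le> 2 * (LQ * (c * \<alpha> n))"
      using y(2) LQ by (simp add: mult_left_mono)
    finally show ?thesis using \<Delta> by (simp add: \<kappa>_def field_simps)
  qed
  have no_switch: "b' n \<le> a n" if n: "1 \<le> n" and lt: "\<kappa> * \<alpha> n < 1" for n
    unfolding a_def b'_def
  proof (rule finite_measure_mono_AE[OF _ ev])
    show "AE \<omega> in M. \<omega> \<in> {\<omega> \<in> space M. I n \<omega> \<notin> opt (X n \<omega>)} \<longrightarrow>
        \<omega> \<in> {\<omega> \<in> space M. I n \<omega> \<notin> opt (X (n - 1) \<omega>)}"
      using steps[OF n] \<Delta>_gap[of n] AE_space
    proof eventually_elim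
      case (elim \<omega>)
      then show ?case
        using switch[OF X_in[OF elim(3)] elim(2) X_in[OF elim(3)] elim(1)] lt by fastforce
    qed
  qed
  \<comment> \<open>Either no switch is possible, or \<open>\<kappa> * \<alpha> n\<close> is at
    least 1 and already exceeds the trivial bound on a probability. This yields a linear term in
    \<open>\<alpha> n\<close>.\<close>
  have b'_le: "b' n \<le> a n + \<kappa> * \<alpha> n" if n: "1 \<le> n" for n
  proof (cases "\<kappa> * \<alpha> n < 1")
    case True
    then show ?thesis using no_switch[OF n] \<kappa>\<alpha>[OF n] by linarith
  next
    case False
    moreover have "b' n \<le> 1" "0 \<le> a n" by (auto simp: a_def b'_def)
    ultimately show ?thesis by linarith
  qed

  \<comment> \<open>The bound for all n from 2 on\<close>
  have part1: "a n \<le> \<eta> ^ (n - 1) * a 1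
      + 2 * c * \<eta> * LQ / (\<Delta> - 4 * \<epsilon>) * (\<Sum>t=1..n - 1. \<eta> ^ (n - 1 - t) * \<alpha> t)
      + (1 - \<eta> ^ (n - 1)) / (1 - \<eta>) * \<delta>" if n: "2 \<le> n" for n
  proof -
    have "a (Suc n) \<le> \<eta> * a n + (\<eta> * \<kappa> * \<alpha> n + \<delta>)" if "1 \<le> n" for n
    proof -
      have "\<eta> * b' n \<le> \<eta> * (a n + \<kappa> * \<alpha> n)" using b'_le[OF that] eta(1) by (rule mult_left_mono)
      then show ?thesis using a_Suc[of n] by (simp add: algebra_simps)
    qed
    then have "a n \<le> \<eta> ^ (n - 1) * a 1 + (\<Sum>t=1..<n. \<eta> ^ (n - 1 - t) * (\<eta> * \<kappa> * \<alpha> t + \<delta>))"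
      using n by (intro affine_recursion_le[OF eta(1)]) auto
    also have "(\<Sum>t=1..<n. \<eta> ^ (n - 1 - t) * (\<eta> * \<kappa> * \<alpha> t + \<delta>))
        = \<eta> * \<kappa> * (\<Sum>t=1..<n. \<eta> ^ (n - 1 - t) * \<alpha> t) + (\<Sum>t=1..<n. \<eta> ^ (n - 1 - t)) * \<delta>"
      by (simp add: distrib_left sum.distrib sum_distrib_left sum_distrib_right mult_ac)
    also have "(\<Sum>t=1..<n. \<eta> ^ (n - 1 - t)) = (1 - \<eta> ^ (n - 1)) / (1 - \<eta>)"
      using eta(2) by (intro sum_power_rev) simp
    also have "{1..<n} = {1..n - 1}" using n by auto
    finally show ?thesis by (simp add: \<kappa>_def mult_ac)
  qed

  \<comment> \<open>The bound from \<open>n\<^sub>0\<close> on\<close>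
  define R where "R = 2 * c * C\<alpha> * LQ / (\<Delta> - 4 * \<epsilon>)"
  define n\<^sub>0 where "n\<^sub>0 = max 2 (1 + nat \<lceil>R powr (1 / p)\<rceil>)"
  have R: "0 \<le> R" using c LQ \<Delta> C\<alpha> by (simp add: R_def)
  \<comment> \<open>\<open>R\<close> is \<open>\<kappa> * C\<alpha>\<close>, so the claim follows
    once t^p exceeds \<open>R\<close>. The summand 1 in \<open>n\<^sub>0\<close> makes this
    strict.\<close>
  have small: "\<kappa> * \<alpha> t < 1" if t: "n\<^sub>0 \<le> t" for t
  proof -
    have t1: "1 \<le> t" and Rt: "R powr (1 / p) < real t"
      using t unfolding n\<^sub>0_def by linarith+
    have "R = (R powr (1 / p)) powr p" using R p by (simp add: powr_powr)
    also have "\<dots> < real t powr p" using Rt p by (intro powr_less_mono2) auto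
    finally have "R * real t powr (- p) < 1"
      using t1 by (simp add: powr_minus field_simps)
    moreover have "\<kappa> * \<alpha> t \<le> \<kappa> * (C\<alpha> * real t powr (- p))"
      using \<alpha>_bound[OF t1] \<kappa> by (rule mult_left_mono)
    moreover have "\<kappa> * (C\<alpha> * real t powr (- p)) = R * real t powr (- p)"
      by (simp add: \<kappa>_def R_def)
    ultimately show ?thesis by linarith
  qed
  have part2: "a n \<le> \<eta> ^ (n - n\<^sub>0) + (1 - \<eta> ^ (n - 1)) / (1 - \<eta>) * \<delta>" if n: "n\<^sub>0 \<le> n" for n
  proof -
    have n0: "2 \<le> n\<^sub>0" by (simp add: n\<^sub>0_def)
    have "a (Suc n) \<le> \<eta> * a n + \<delta>" if "n\<^sub>0 \<le> n" for n
      using a_Suc[of n] mult_left_mono[OF no_switch[OF _ small[OF that]] eta(1)] that n0 by simp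
    then have "a n \<le> \<eta> ^ (n - n\<^sub>0) * a n\<^sub>0 + (\<Sum>t=n\<^sub>0..<n. \<eta> ^ (n - 1 - t) * \<delta>)"
      using n by (intro affine_recursion_le[OF eta(1)]) auto
    also have "(\<Sum>t=n\<^sub>0..<n. \<eta> ^ (n - 1 - t) * \<delta>) = (1 - \<eta> ^ (n - n\<^sub>0)) / (1 - \<eta>) * \<delta>"
      using eta(2) by (subst sum_power_rev[symmetric]) (simp, rule sum_distrib_right[symmetric])
    \<comment> \<open>Unrolling from \<open>n\<^sub>0\<close> gives the exponent
      \<open>n - n\<^sub>0\<close>; raising it to \<open>n - 1\<close> only enlarges the bound, as 0
      <= \<open>\<eta>\<close> < 1 and \<open>n\<^sub>0\<close> is at least 2.\<close>
    also have "\<dots> \<le> (1 - \<eta> ^ (n - 1)) / (1 - \<eta>) * \<delta>"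
      using eta \<delta> n n0
      by (intro mult_right_mono divide_right_mono diff_left_mono power_decreasing) auto
    also have "\<eta> ^ (n - n\<^sub>0) * a n\<^sub>0 \<le> \<eta> ^ (n - n\<^sub>0)"
      using eta(1) by (intro mult_left_le) (auto simp: a_def)
    finally show ?thesis by simp
  qed
  show ?thesis
    unfolding Let_def
    using part1 part2 unfolding n\<^sub>0_def R_def a_def opt_def \<delta>_def
    by (simp add: mult.assoc)
qed

end
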